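(* Let $\mu,\nu$ be two positive Borel measures on $\mathbb{D}$ and $\delta\in(0,1)$, with $\mu(T_\delta(I))>0$ for every dyadic arc $I\in\mathcal{D}$, and let $\{T_\delta(I)^\ast\}_{I\in\mathcal{D}}$ be a family of thickenings of the tops with bounded overlap. Then the condition $\mathrm{RC}^\delta_{\mu\to\nu}$ holds if and only if the top-maximal operator $\mathcal{N}^\delta_\mu$ is of weak type $(1,1)$ from $L^1(\mu)$ to $L^{1,\infty}(\nu)$; that is, if and only if there is a constant $C>0$ such that for all $g\in L^1(\mu)$ and all $\lambda>0$, $$\nu\big(\{z\in\mathbb{D}:\mathcal{N}^\delta_\mu g(z)>\lambda\}\big)\le\frac{C}{\lambda}\int_{\mathbb{D}}|g|\,d\mu.$$
   Context: $\mathbb{D}$ is the open unit disk. Identify $\partial\mathbb{D}$ with $\mathbb{T}\cong[0,1)$ (so arc length is normalized to total length $1$). For an arc $I\subset\partial\mathbb{D}$ of length $|I|$ and $\delta\in(0,1)$, the Carleson box and its top are $$S(I)=\{z\in\mathbb{D}: z/|z|\in I,\ 1-|I|<|z|<1\},\qquad T_\delta(I)=\{z\in\mathbb{D}: z/|z|\in I,\ 1-|I|<|z|<1-\delta|I|\}.$$ The dyadic arcs are $I_{j,m}=[m/2^j,(m+1)/2^j)$, $j\ge0$, $0\le m<2^j$; $\mathcal{D}$ is the collection of all of them. Thickenings with bounded overlap: measurable sets $T_\delta(I)^\ast\subseteq\mathbb{D}$ with $T_\delta(I)\subseteq T_\delta(I)^\ast$ for every $I\in\mathcal{D}$, and a constant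 $N>0$ with $\sum_{I\in\mathcal{D}}\mathbf{1}_{T_\delta(I)^\ast}(x)\le N$ for all $x\in\mathbb{D}$. Two-weight reverse Carleson tail condition $\mathrm{RC}^\delta_{\mu\to\nu}$: there exists $\kappa>0$ such that $\nu(S(I))\le(1+\kappa)\mu(T_\delta(I))$ for all $I\in\mathcal{D}$. Top-maximal operator: $$(\mathcal{N}^\delta_\mu g)(z)=\sup_{I\in\mathcal{D},\ z\in S(I)}\frac{1}{\mu(T_\delta(I))}\int_{T_\delta(I)^\ast}|g|\,d\mu,$$ with the conventions $1/(+\infty)=0$ and $\sup\emptyset=0$. *)

theory Defs
  imports "HOL-Analysis.Analysis"
begin

text \<open>
  An arc of the unit circle is given by its set of parameters \<open>I \<subseteq> [0,1)\<close>, where \<open>t\<close> stands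
  for the point \<open>exp (2 pi i t)\<close>. The normalized arc length is then the Lebesgue measure
  of \<open>I\<close>.
\<close>

definition arc_points :: "real set \<Rightarrow> complex set" where
  "arc_points I = (\<lambda>t. cis (2 * pi * t)) ` I"

definition arc_length :: "real set \<Rightarrow> real" where
  "arc_length I = measure lborel I"

text \<open>The origin lies in no box: \<open>z / 0 = 0\<close> is not a point of the unit circle.\<close>

definition carleson_box :: "real set \<Rightarrow> complex set" where
  "carleson_box I = {z \<in> ball 0 1. z / complex_of_real (norm z) \<in> arc_points I \<and>
     1 - arc_length I < norm z \<and> norm z < 1}"

definition carleson_top :: "real \<Rightarrow> real set \<Rightarrow> complex set" where
  "carleson_top \<delta> I = {z \<in> ball 0 1. z / complex_of_real (norm z) \<in> arc_points I \<and>
     1 - arc_length I < norm z \<and> norm z < 1 - \<delta> * arc_length I}"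

definition dyadic_arc :: "nat \<Rightarrow> nat \<Rightarrow> real set" where
  "dyadic_arc j m = {real m / 2 ^ j ..< (real m + 1) / 2 ^ j}"

definition dyadic_arcs :: "real set set" where
  "dyadic_arcs = {dyadic_arc j m | j m. m < 2 ^ j}"

definition borel_measure_on_disk :: "complex measure \<Rightarrow> bool" where
  "borel_measure_on_disk \<mu> \<longleftrightarrow> sets \<mu> = sets (restrict_space borel (ball 0 1))"

definition bounded_overlap_thickening :: "real \<Rightarrow> (real set \<Rightarrow> complex set) \<Rightarrow> bool" where
  "bounded_overlap_thickening \<delta> Tst \<longleftrightarrow>
     (\<forall>I\<in>dyadic_arcs. Tst I \<in> sets borel \<and> Tst I \<subseteq> ball 0 1 \<and> carleson_top \<delta> I \<subseteq> Tst I) \<and>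
     (\<exists>N::real. N > 0 \<and>
        (\<forall>x\<in>ball 0 1. (\<Sum>\<^sub>\<infinity>I\<in>dyadic_arcs. (indicator (Tst I) x :: ennreal)) \<le> ennreal N))"

definition reverse_carleson_tail :: "real \<Rightarrow> complex measure \<Rightarrow> complex measure \<Rightarrow> bool" where
  "reverse_carleson_tail \<delta> \<mu> \<nu> \<longleftrightarrow>
     (\<exists>\<kappa>::real. \<kappa> > 0 \<and>
        (\<forall>I\<in>dyadic_arcs.
           emeasure \<nu> (carleson_box I) \<le> ennreal (1 + \<kappa>) * emeasure \<mu> (carleson_top \<delta> I)))"

text \<open>
  In \<^typ>\<open>ennreal\<close> one has \<open>a / \<infinity> = 0\<close> and \<open>Sup {} = 0\<close>.
\<close>

definition top_maximal ::
  "real \<Rightarrow> complex measure \<Rightarrow> (real set \<Rightarrow> complex set) \<Rightarrow> (complex \<Rightarrow> complex) \<Rightarrow> complex \<Rightarrow> ennreal"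
where
  "top_maximal \<delta> \<mu> Tst g z =
     (SUP I\<in>{I \<in> dyadic_arcs. z \<in> carleson_box I}.
        (1 / emeasure \<mu> (carleson_top \<delta> I)) * (\<integral>\<^sup>+w\<in>Tst I. ennreal (norm (g w)) \<partial>\<mu>))"

definition weak_type_1_1 ::
  "((complex \<Rightarrow> complex) \<Rightarrow> complex \<Rightarrow> ennreal) \<Rightarrow> complex measure \<Rightarrow> complex measure \<Rightarrow> bool"
where
  "weak_type_1_1 A \<mu> \<nu> \<longleftrightarrow>
     (\<exists>C::real. C > 0 \<and>
        (\<forall>g. integrable \<mu> g \<longrightarrow>
          (\<forall>l::real. l > 0 \<longrightarrow>
             emeasure \<nu> {z \<in> ball 0 1. A g z > ennreal l}
               \<le> ennreal (C / l) * (\<integral>\<^sup>+w. ennreal (norm (g w)) \<partial>\<mu>))))"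

text \<open>
  \<^const>\<open>emeasure\<close> vanishes on non-measurable sets; the following lemmas show that all sets
  measured above are Borel sets.
\<close>

lemma arc_points_dyadic_borel: "arc_points (dyadic_arc j m) \<in> sets borel"
proof -
  define a b where "a = real m / 2 ^ j" and "b = (real m + 1) / 2 ^ j"
  have "{a..<b} = (\<Union>n. {a..b - 1 / real (Suc n)})"
  proof (intro set_eqI iffI)
    fix x assume x: "x \<in> {a..<b}"
    then obtain n where "1 / real (Suc n) < b - x"
      using nat_approx_posE[of "b - x"] by auto
    then show "x \<in> (\<Union>n. {a..b - 1 / real (Suc n)})"
      using x by (auto intro!: exI[of _ n])
  next
    fix x assume "x \<in> (\<Union>n. {a..b - 1 / real (Suc n)})"
    then obtain n where "a \<le> x" "x \<le> b - 1 / real (Suc n)" by auto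
    moreover have "1 / real (Suc n) > 0" by simp
    ultimately show "x \<in> {a..<b}" unfolding atLeastLessThan_iff by linarith
  qed
  then have "arc_points (dyadic_arc j m) =
      (\<Union>n. (\<lambda>t. cis (2 * pi * t)) ` {a..b - 1 / real (Suc n)})"
    unfolding arc_points_def dyadic_arc_def a_def b_def by (simp only: image_UN)
  moreover have "(\<lambda>t. cis (2 * pi * t)) ` {a..b - 1 / real (Suc n)} \<in> sets borel" for n
    by (intro borel_compact compact_continuous_image continuous_intros compact_Icc)
  ultimately show ?thesis by auto
qed

lemma carleson_sets_borel:
  assumes "I \<in> dyadic_arcs"
  shows "carleson_box I \<in> sets borel" and "carleson_top \<delta> I \<in> sets borel"
proof -
  have A[measurable]: "arc_points I \<in> sets borel"
    using assms arc_points_dyadic_borel by (auto simp: dyadic_arcs_def)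
  show "carleson_box I \<in> sets borel" "carleson_top \<delta> I \<in> sets borel"
    unfolding carleson_box_def carleson_top_def mem_ball_0 by measurable
qed

lemma countable_dyadic_arcs: "countable dyadic_arcs"
proof -
  have "dyadic_arcs \<subseteq> (\<lambda>(j, m). dyadic_arc j m) ` UNIV"
    by (auto simp: dyadic_arcs_def)
  then show ?thesis by (rule countable_subset) simp
qed

lemma top_maximal_superlevel_borel:
  "{z \<in> ball 0 1. top_maximal \<delta> \<mu> Tst g z > l} \<in> sets borel"
proof -
  define D where "D = {I \<in> dyadic_arcs.
    l < (1 / emeasure \<mu> (carleson_top \<delta> I)) * (\<integral>\<^sup>+w\<in>Tst I. ennreal (norm (g w)) \<partial>\<mu>)}"
  have "{z \<in> ball 0 1. top_maximal \<delta> \<mu> Tst g z > l} = (\<Union>I\<in>D. carleson_box I)"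
    unfolding top_maximal_def less_SUP_iff D_def by (auto simp: carleson_box_def)
  moreover have "countable D"
    unfolding D_def by (rule countable_subset[OF _ countable_dyadic_arcs]) auto
  ultimately show ?thesis
    using carleson_sets_borel(1) by (auto simp: D_def)
qed

end

theory Submission
  imports Defs
begin

text \<open>
  The superlevel set of the top-maximal operator is the union of the boxes over the dyadic arcs
  whose average exceeds \<open>\<lambda>\<close>. No selection of maximal arcs is needed: the measures of all these
  boxes can be summed, since the bounded overlap of the thickenings controls the sum of the integrals.
  Conversely, testing the weak type inequality on the indicator of a top of finite measure at
  \<open>\<lambda> = 1/2\<close> gives the tail condition; it is trivial for tops of infinite measure.
\<close>

text \<open>Finite subadditivity bounds every finite subunion by \<open>B\<close>, and continuity
  from below carries the bound to the whole union. The hypothesis on finite subfamilies lets sums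
  and integrals be interchanged over finitely many arcs only.\<close>

lemma emeasure_UN_le_of_finite_sums:
  assumes D: "countable D" and X: "\<And>i. i \<in> D \<Longrightarrow> X i \<in> sets M"
    and B: "\<And>F. finite F \<Longrightarrow> F \<subseteq> D \<Longrightarrow> (\<Sum>i\<in>F. emeasure M (X i)) \<le> B"
  shows "emeasure M (\<Union>i\<in>D. X i) \<le> B"
proof (cases "D = {}")
  case False
  \<comment> \<open>The enumeration may repeat indices, for instance when \<open>D\<close> is
    finite. As a set, \<open>F n\<close> still contains each index once, so \<open>B\<close> applies
    to the sum over it.\<close>
  define F where "F n = from_nat_into D ` {..n}" for n
  have F: "finite (F n)" "F n \<subseteq> D" for n
    using from_nat_into[OF False] by (auto simp: F_def)
  have "(\<Union>i\<in>D. X i) = (\<Union>i\<in>range (from_nat_into D). X i)"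
    using range_from_nat_into[OF False D] by simp
  also have "\<dots> = (\<Union>n. \<Union>i\<in>F n. X i)"
    by (auto simp: F_def)
  finally have "emeasure M (\<Union>i\<in>D. X i) = (SUP n. emeasure M (\<Union>i\<in>F n. X i))"
    using SUP_emeasure_incseq[of "\<lambda>n. \<Union>i\<in>F n. X i" M] F X
    by (fastforce simp: incseq_def F_def)
  also have "\<dots> \<le> B"
  proof (rule SUP_least)
    fix n
    have "emeasure M (\<Union>i\<in>F n. X i) \<le> (\<Sum>i\<in>F n. emeasure M (X i))"
      using F X by (intro emeasure_subadditive_finite) auto
    then show "emeasure M (\<Union>i\<in>F n. X i) \<le> B"
      using B[OF F] by (rule order_trans)
  qed
  finally show ?thesis .
qed simp

lemma disk_sets:
  assumes "borel_measure_on_disk M" "A \<in> sets borel" "A \<subseteq> ball 0 1"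
  shows "A \<in> sets M"
  using assms by (auto simp: borel_measure_on_disk_def sets_restrict_space_iff)

lemma space_disk: "borel_measure_on_disk M \<Longrightarrow> space M = ball 0 1"
  by (auto simp: borel_measure_on_disk_def space_restrict_space dest: sets_eq_imp_space_eq)

lemma carleson_sets_subset_disk:
  "carleson_box I \<subseteq> ball 0 1" "carleson_top \<delta> I \<subseteq> ball 0 1"
  by (auto simp: carleson_box_def carleson_top_def)

text \<open>After interchanging sum and integral, the integrand is \<open>f\<close> times the number
  of sets \<open>A i\<close> that contain the point.\<close>

lemma sum_set_nn_integral_le:
  assumes [measurable]: "f \<in> borel_measurable M"
    and A: "\<And>i. i \<in> F \<Longrightarrow> A i \<in> sets M"
    and N: "\<And>x. x \<in> space M \<Longrightarrow> (\<Sum>i\<in>F. indicator (A i) x) \<le> N"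
  shows "(\<Sum>i\<in>F. \<integral>\<^sup>+x\<in>A i. f x \<partial>M) \<le> N * (\<integral>\<^sup>+x. f x \<partial>M)"
proof -
  have "(\<Sum>i\<in>F. \<integral>\<^sup>+x\<in>A i. f x \<partial>M) = (\<integral>\<^sup>+x. (\<Sum>i\<in>F. f x * indicator (A i) x) \<partial>M)"
    using A by (intro nn_integral_sum[symmetric]) auto
  also have "\<dots> \<le> (\<integral>\<^sup>+x. N * f x \<partial>M)"
    using N by (intro nn_integral_mono)
      (auto simp: sum_distrib_left[symmetric] mult.commute[of N] intro!: mult_left_mono)
  also have "\<dots> = N * (\<integral>\<^sup>+x. f x \<partial>M)"
    by (intro nn_integral_cmult) auto
  finally show ?thesis .
qed

text \<open>With \<open>m\<close> a measure and \<open>a\<close> an integral, this is Chebyshev's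
  step. Clearing the denominator needs \<open>m\<close> finite, which the strict inequality forces:
  for infinite \<open>m\<close> the average is 0, even if \<open>a\<close> is infinite.\<close>

lemma ennreal_average_gtD:
  fixes a m :: ennreal and l :: real
  assumes l: "0 < l" and m: "0 < m" and less: "ennreal l < 1 / m * a"
  shows "m \<le> ennreal (1 / l) * a"
proof -
  have "m \<noteq> \<infinity>"
    using less by (auto simp: divide_ennreal_def)
  then have "1 / m * m = 1"
    using m by (simp add: ennreal_times_divide mult.commute top.not_eq_extremum)
  have "ennreal l * m \<le> 1 / m * a * m"
    using less by (intro mult_right_mono) auto
  also have "\<dots> = a"
    using \<open>1 / m * m = 1\<close> by (metis mult.commute mult.left_commute mult_1)
  finally have "ennreal (1 / l) * (ennreal l * m) \<le> ennreal (1 / l) * a"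
    by (intro mult_left_mono) auto
  moreover have "ennreal (1 / l) * (ennreal l * m) = m"
    using l by (simp add: mult.assoc[symmetric] ennreal_mult[symmetric])
  ultimately show ?thesis by simp
qed

text \<open>The tail condition costs a factor \<open>1 + \<kappa>\<close> for each selected box and
  the overlap a factor \<open>N\<close> for the whole sum, hence the constant
  \<open>(1 + \<kappa>) * N\<close>.\<close>

lemma weak_type_if_reverse_carleson_tail:
  assumes \<mu>: "borel_measure_on_disk \<mu>" and \<nu>: "borel_measure_on_disk \<nu>"
    and pos: "\<And>I. I \<in> dyadic_arcs \<Longrightarrow> emeasure \<mu> (carleson_top \<delta> I) > 0"
    and Tst: "bounded_overlap_thickening \<delta> Tst"
    and rc: "reverse_carleson_tail \<delta> \<mu> \<nu>"
  shows "weak_type_1_1 (top_maximal \<delta> \<mu> Tst) \<mu> \<nu>"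
proof -
  obtain \<kappa> where \<kappa>: "\<kappa> > 0" and box: "\<And>I. I \<in> dyadic_arcs \<Longrightarrow>
      emeasure \<nu> (carleson_box I) \<le> ennreal (1 + \<kappa>) * emeasure \<mu> (carleson_top \<delta> I)"
    using rc by (auto simp: reverse_carleson_tail_def)
  obtain N :: real where N: "N > 0" and overlap: "\<And>x. x \<in> ball 0 1 \<Longrightarrow>
      (\<Sum>\<^sub>\<infinity>I\<in>dyadic_arcs. (indicator (Tst I) x :: ennreal)) \<le> ennreal N"
    using Tst unfolding bounded_overlap_thickening_def by blast
  have Tst_sets: "Tst I \<in> sets \<mu>" if "I \<in> dyadic_arcs" for I
    using that Tst disk_sets[OF \<mu>] by (auto simp: bounded_overlap_thickening_def)
  have "emeasure \<nu> {z \<in> ball 0 1. top_maximal \<delta> \<mu> Tst g z > ennreal l}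
      \<le> ennreal ((1 + \<kappa>) * N / l) * (\<integral>\<^sup>+w. ennreal (norm (g w)) \<partial>\<mu>)"
    if g: "integrable \<mu> g" and l: "l > 0" for g :: "complex \<Rightarrow> complex" and l :: real
  proof -
    define a where "a I = (\<integral>\<^sup>+w\<in>Tst I. ennreal (norm (g w)) \<partial>\<mu>)" for I
    define D where
      "D = {I \<in> dyadic_arcs. ennreal l < 1 / emeasure \<mu> (carleson_top \<delta> I) * a I}"
    have [measurable]: "g \<in> borel_measurable \<mu>"
      using g by auto
    have D: "D \<subseteq> dyadic_arcs" by (auto simp: D_def)
    have top: "emeasure \<mu> (carleson_top \<delta> I) \<le> ennreal (1 / l) * a I" if "I \<in> D" for I
      using that l pos[of I] ennreal_average_gtD by (auto simp: D_def)
    \<comment> \<open>A supremum is strictly above \<open>l\<close> exactly when one of its terms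
      is; it need not be attained.\<close>
    have "{z \<in> ball 0 1. top_maximal \<delta> \<mu> Tst g z > ennreal l} = (\<Union>I\<in>D. carleson_box I)"
      unfolding top_maximal_def less_SUP_iff D_def a_def by (auto simp: carleson_box_def)
    also have "emeasure \<nu> \<dots> \<le> ennreal ((1 + \<kappa>) * N / l) * (\<integral>\<^sup>+w. ennreal (norm (g w)) \<partial>\<mu>)"
    proof (rule emeasure_UN_le_of_finite_sums)
      show "countable D"
        using D countable_dyadic_arcs by (rule countable_subset)
      show "carleson_box I \<in> sets \<nu>" if "I \<in> D" for I
        using that D carleson_sets_borel(1) carleson_sets_subset_disk by (intro disk_sets[OF \<nu>]) auto
      fix F assume F: "finite F" "F \<subseteq> D"
      have "(\<Sum>I\<in>F. emeasure \<nu> (carleson_box I)) \<le> (\<Sum>I\<in>F. ennreal (1 + \<kappa>) * (ennreal (1 / l) * a I))"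
        using F D by (intro sum_mono order_trans[OF box] mult_left_mono top) auto
      also have "\<dots> = ennreal (1 + \<kappa>) * ennreal (1 / l) * (\<Sum>I\<in>F. a I)"
        by (simp add: sum_distrib_left mult.assoc)
      also have "(\<Sum>I\<in>F. a I) \<le> ennreal N * (\<integral>\<^sup>+w. ennreal (norm (g w)) \<partial>\<mu>)"
        unfolding a_def
      proof (rule sum_set_nn_integral_le)
        show "Tst I \<in> sets \<mu>" if "I \<in> F" for I
          using that F D Tst_sets by auto
        fix x assume "x \<in> space \<mu>"
        then have x: "x \<in> ball 0 1" using space_disk[OF \<mu>] by auto
        \<comment> \<open>In \<open>ennreal\<close> every family is summable and all terms are
          nonnegative, so a finite partial sum is at most the infinite sum.\<close>
        have "(\<Sum>I\<in>F. (indicator (Tst I) x :: ennreal)) \<le> (\<Sum>\<^sub>\<infinity>I\<in>dyadic_arcs. indicator (Tst I) x)"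
          unfolding infsum_finite[OF F(1), symmetric]
          using F D by (intro infsum_mono_neutral nonneg_summable_on_complete) auto
        then show "(\<Sum>I\<in>F. (indicator (Tst I) x :: ennreal)) \<le> ennreal N"
          using overlap[OF x] by (rule order_trans)
      qed auto
      finally have "(\<Sum>I\<in>F. emeasure \<nu> (carleson_box I))
          \<le> ennreal (1 + \<kappa>) * ennreal (1 / l) * (ennreal N * (\<integral>\<^sup>+w. ennreal (norm (g w)) \<partial>\<mu>))"
        by (simp add: mult_left_mono)
      moreover have "ennreal ((1 + \<kappa>) * N / l) = ennreal (1 + \<kappa>) * ennreal (1 / l) * ennreal N"
      proof -
        have "0 \<le> 1 + \<kappa>" "0 \<le> 1 / l" "0 \<le> (1 + \<kappa>) * (1 / l)" "0 \<le> N"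
          using \<kappa> N l by simp_all
        then have "ennreal (1 + \<kappa>) * ennreal (1 / l) * ennreal N = ennreal ((1 + \<kappa>) * (1 / l) * N)"
          by (simp only: ennreal_mult)
        then show ?thesis by (simp add: mult.commute)
      qed
      ultimately show "(\<Sum>I\<in>F. emeasure \<nu> (carleson_box I))
          \<le> ennreal ((1 + \<kappa>) * N / l) * (\<integral>\<^sup>+w. ennreal (norm (g w)) \<partial>\<mu>)"
        by (simp only: mult.assoc)
    qed
    finally show ?thesis .
  qed
  moreover have "(1 + \<kappa>) * N > 0" using \<kappa> N by simp
  ultimately show ?thesis unfolding weak_type_1_1_def by blast
qed

text \<open>The indicator of a top has average exactly 1 for its own arc, so its maximal function is
  at least 1 on the whole box, while its norm is the measure of the top.\<close>

lemma reverse_carleson_tail_if_weak_type: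
  assumes \<mu>: "borel_measure_on_disk \<mu>" and \<nu>: "borel_measure_on_disk \<nu>"
    and pos: "\<And>I. I \<in> dyadic_arcs \<Longrightarrow> emeasure \<mu> (carleson_top \<delta> I) > 0"
    and Tst: "\<And>I. I \<in> dyadic_arcs \<Longrightarrow> carleson_top \<delta> I \<subseteq> Tst I"
    and weak: "weak_type_1_1 (top_maximal \<delta> \<mu> Tst) \<mu> \<nu>"
  shows "reverse_carleson_tail \<delta> \<mu> \<nu>"
proof -
  obtain C where C: "C > 0" and bound: "\<And>g l. integrable \<mu> g \<Longrightarrow> l > 0 \<Longrightarrow>
      emeasure \<nu> {z \<in> ball 0 1. top_maximal \<delta> \<mu> Tst g z > ennreal l}
        \<le> ennreal (C / l) * (\<integral>\<^sup>+w. ennreal (norm (g w)) \<partial>\<mu>)"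
    using weak unfolding weak_type_1_1_def by blast
  \<comment> \<open>\<open>2 * C\<close> is \<open>C / l\<close> at \<open>l = 1/2\<close>; the
    added 1 is slack that gives the constant the form \<open>1 + \<kappa>\<close>.\<close>
  have "emeasure \<nu> (carleson_box I) \<le> ennreal (1 + 2 * C) * emeasure \<mu> (carleson_top \<delta> I)"
    if I: "I \<in> dyadic_arcs" for I
  proof (cases "emeasure \<mu> (carleson_top \<delta> I) = \<infinity>")
    \<comment> \<open>The right-hand side is infinite, and the indicator of the top would not be
      integrable.\<close>
    case True
    then show ?thesis using C by (simp add: ennreal_mult_top)
  next
    case False
    let ?T = "carleson_top \<delta> I"
    define g where "g = (indicator ?T :: complex \<Rightarrow> complex)"
    have T: "?T \<in> sets \<mu>"
      using I carleson_sets_borel(2) carleson_sets_subset_disk by (intro disk_sets[OF \<mu>])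
    have g: "integrable \<mu> g"
    proof -
      have "g = (\<lambda>w. indicator ?T w *\<^sub>R 1)"
        by (auto simp: g_def indicator_def fun_eq_iff)
      then show ?thesis
        using T False by (simp add: top.not_eq_extremum)
    qed
    have norm_g: "ennreal (norm (g w)) = indicator ?T w" for w
      by (auto simp: g_def indicator_def)
    have "ennreal (norm (g w)) * indicator (Tst I) w = indicator ?T w" for w
      using Tst[OF I] unfolding norm_g by (auto simp: indicator_def)
    then have "(\<integral>\<^sup>+w\<in>Tst I. ennreal (norm (g w)) \<partial>\<mu>) = emeasure \<mu> ?T"
      using T by simp
    \<comment> \<open>The measure of the top is positive and finite, so the quotient cancels to
      1.\<close>
    then have average: "1 / emeasure \<mu> ?T * (\<integral>\<^sup>+w\<in>Tst I. ennreal (norm (g w)) \<partial>\<mu>) = 1"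
      using False pos[OF I] by (simp add: ennreal_times_divide mult.commute top.not_eq_extremum)
    have "top_maximal \<delta> \<mu> Tst g z \<ge> 1" if "z \<in> carleson_box I" for z
      unfolding top_maximal_def using I that by (intro SUP_upper2[where i = I]) (simp_all only: average, auto)
    \<comment> \<open>The superlevel set is strict and the lower bound is 1, so the level has to lie
      strictly below 1.\<close>
    moreover have "ennreal (1 / 2) < 1"
      by (subst ennreal_less_one_iff) simp
    ultimately have "carleson_box I \<subseteq> {z \<in> ball 0 1. top_maximal \<delta> \<mu> Tst g z > ennreal (1 / 2)}"
      using carleson_sets_subset_disk(1) by (blast intro: less_le_trans)
    then have "emeasure \<nu> (carleson_box I)
        \<le> emeasure \<nu> {z \<in> ball 0 1. top_maximal \<delta> \<mu> Tst g z > ennreal (1 / 2)}"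
      \<comment> \<open>Monotonicity needs the larger set to be measurable, since
        \<open>emeasure\<close> would otherwise be 0 on it.\<close>
      by (intro emeasure_mono disk_sets[OF \<nu>] top_maximal_superlevel_borel) auto
    also have "\<dots> \<le> ennreal (C / (1 / 2)) * emeasure \<mu> ?T"
      using bound[OF g, of "1 / 2"] T by (simp add: norm_g)
    also have "\<dots> \<le> ennreal (1 + 2 * C) * emeasure \<mu> ?T"
      by (intro mult_right_mono ennreal_leI) auto
    finally show ?thesis .
  qed
  moreover have "2 * C > 0" using C by simp
  ultimately show ?thesis unfolding reverse_carleson_tail_def by blast
qed

theorem theorem1p17:
  fixes \<mu> \<nu> :: "complex measure" and \<delta> :: real and Tst :: "real set \<Rightarrow> complex set"
  assumes "borel_measure_on_disk \<mu>" and "borel_measure_on_disk \<nu>"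
    and "0 < \<delta>" and "\<delta> < 1"
    and "\<And>I. I \<in> dyadic_arcs \<Longrightarrow> emeasure \<mu> (carleson_top \<delta> I) > 0"
    and "bounded_overlap_thickening \<delta> Tst"
  shows "reverse_carleson_tail \<delta> \<mu> \<nu> \<longleftrightarrow> weak_type_1_1 (top_maximal \<delta> \<mu> Tst) \<mu> \<nu>"
proof
  show "weak_type_1_1 (top_maximal \<delta> \<mu> Tst) \<mu> \<nu>" if "reverse_carleson_tail \<delta> \<mu> \<nu>"
    using assms(1,2,5,6) that by (rule weak_type_if_reverse_carleson_tail)
  show "reverse_carleson_tail \<delta> \<mu> \<nu>" if "weak_type_1_1 (top_maximal \<delta> \<mu> Tst) \<mu> \<nu>"
    using assms(1,2,5) _ that
    by (rule reverse_carleson_tail_if_weak_type)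
      (use assms(6) in \<open>auto simp: bounded_overlap_thickening_def\<close>)
qed

end
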